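(* Let $\vec S$ be the inverse limit of an inverse system $(\vec S_p\mid p\in P)$ of finite separation systems, equipped with the inverse-limit topology, and suppose $\vec S$ is a tree set. Then $\vec S$ is normal if and only if $\vec S$ contains no infinite star.
   Context: A separation system $(\vec S,\le,{}^* )$ is a poset with an order-reversing involution $\vec s\mapsto\overleftarrow s$; $s=\{\vec s,\overleftarrow s\}$. $\vec s$ is degenerate if $\vec s=\overleftarrow s$. $\vec r$ is trivial if there is $s\ne r$ with $\vec r<\vec s$ and $\vec r<\overleftarrow s$. Separations are nested if they have comparable orientations. A tree set is a nested separation system (all elements pairwise nested) without degenerate or trivial elements. A star is a set $\sigma$ with $\vec r\le\overleftarrow s$ for all distinct $\vec r,\vec s\in\sigma$. An orientation contains exactly one orientation of each separation; it is consistent if it contains no $\overleftarrow r,\vec s$ with $r\ne s$ and $\vec r<\vec s$. A consistent orientation $O$ splits if $O$ is contained in the down-closure of the set of its maximal elements. $P$ is a directed poset, $f_{qp}\colon\vec S_q\to\vec S_p$ ($p<q$) are compatible homomorphisms of separation systems (maps commuting with the involutions and preserving $\le$); $\vec S$ consists of families $(\vec s_p)$ with $f_{qp}(\vec s_q)=\vec s_p$, ordered and with involution componentwise, topologized as a subspace of the product of the discrete $\vec S_p$. A nested $\vec S$ is normal if its consistent orientations that split are exactly its consistent orientations that are closed in $\vec S$. *)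

theory Defs
  imports "HOL-Analysis.Analysis"
begin

text \<open>
  A separation system is a carrier set together with a relation and a map on the
  ambient type; only their behaviour on the carrier matters.  Elements of the
  carrier are the \<^emph>\<open>oriented\<close> separations.
\<close>

record 'a sepsys =
  seps :: "'a set"
  le :: "'a \<Rightarrow> 'a \<Rightarrow> bool"
  invol :: "'a \<Rightarrow> 'a"

locale separation_system =
  fixes S :: "'a sepsys"
  assumes le_refl: "reflp_on (seps S) (le S)"
    and le_antisym: "antisymp_on (seps S) (le S)"
    and le_trans: "transp_on (seps S) (le S)"
    and invol_closed: "invol S \<in> seps S \<rightarrow> seps S"
    and involution: "\<And>s. s \<in> seps S \<Longrightarrow> invol S (invol S s) = s"
    and order_reversing:
      "\<And>r s. \<lbrakk>r \<in> seps S; s \<in> seps S; le S r s\<rbrakk> \<Longrightarrow> le S (invol S s) (invol S r)"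

definition lt :: "'a sepsys \<Rightarrow> 'a \<Rightarrow> 'a \<Rightarrow> bool" where
  "lt S r s \<longleftrightarrow> le S r s \<and> r \<noteq> s"

text \<open>The unoriented separation underlying an oriented one.\<close>

definition unor :: "'a sepsys \<Rightarrow> 'a \<Rightarrow> 'a set" where
  "unor S s = {s, invol S s}"

definition degenerate :: "'a sepsys \<Rightarrow> 'a \<Rightarrow> bool" where
  "degenerate S s \<longleftrightarrow> s = invol S s"

definition trivial :: "'a sepsys \<Rightarrow> 'a \<Rightarrow> bool" where
  "trivial S r \<longleftrightarrow>
     (\<exists>s\<in>seps S. unor S s \<noteq> unor S r \<and> lt S r s \<and> lt S r (invol S s))"

definition nested_pair :: "'a sepsys \<Rightarrow> 'a \<Rightarrow> 'a \<Rightarrow> bool" where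
  "nested_pair S r s \<longleftrightarrow>
     (\<exists>r'\<in>unor S r. \<exists>s'\<in>unor S s. le S r' s' \<or> le S s' r')"

definition nested :: "'a sepsys \<Rightarrow> bool" where
  "nested S \<longleftrightarrow> (\<forall>r\<in>seps S. \<forall>s\<in>seps S. nested_pair S r s)"

locale tree_set = separation_system S for S :: "'a sepsys" +
  assumes nested_seps: "nested S"
    and no_degenerate: "\<And>s. s \<in> seps S \<Longrightarrow> \<not> degenerate S s"
    and no_trivial: "\<And>s. s \<in> seps S \<Longrightarrow> \<not> trivial S s"

definition star :: "'a sepsys \<Rightarrow> 'a set \<Rightarrow> bool" where
  "star S \<sigma> \<longleftrightarrow>
     \<sigma> \<subseteq> seps S \<and> (\<forall>r\<in>\<sigma>. \<forall>s\<in>\<sigma>. r \<noteq> s \<longrightarrow> le S r (invol S s))"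

definition orientation :: "'a sepsys \<Rightarrow> 'a set \<Rightarrow> bool" where
  "orientation S Q \<longleftrightarrow>
     Q \<subseteq> seps S \<and> (\<forall>s\<in>seps S. \<exists>!r. r \<in> unor S s \<and> r \<in> Q)"

definition consistent :: "'a sepsys \<Rightarrow> 'a set \<Rightarrow> bool" where
  "consistent S Q \<longleftrightarrow>
     \<not> (\<exists>r\<in>seps S. \<exists>s\<in>seps S.
          invol S r \<in> Q \<and> s \<in> Q \<and> unor S r \<noteq> unor S s \<and> lt S r s)"

definition maximal_elements :: "'a sepsys \<Rightarrow> 'a set \<Rightarrow> 'a set" where
  "maximal_elements S Q = {m \<in> Q. \<not> (\<exists>s\<in>Q. lt S m s)}"

definition down_closure :: "'a sepsys \<Rightarrow> 'a set \<Rightarrow> 'a set" where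
  "down_closure S A = {r \<in> seps S. \<exists>s\<in>A. le S r s}"

definition splits :: "'a sepsys \<Rightarrow> 'a set \<Rightarrow> bool" where
  "splits S Q \<longleftrightarrow> Q \<subseteq> down_closure S (maximal_elements S Q)"

definition sepsys_hom :: "'a sepsys \<Rightarrow> 'b sepsys \<Rightarrow> ('a \<Rightarrow> 'b) \<Rightarrow> bool" where
  "sepsys_hom S T f \<longleftrightarrow>
     f \<in> seps S \<rightarrow> seps T \<and>
     (\<forall>s\<in>seps S. f (invol S s) = invol T (f s)) \<and>
     (\<forall>r\<in>seps S. \<forall>s\<in>seps S. le S r s \<longrightarrow> le T (f r) (f s))"

locale directed_poset =
  fixes P :: "'i set" and leP :: "'i \<Rightarrow> 'i \<Rightarrow> bool"
  assumes reflP: "reflp_on P leP"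
    and antisymP: "antisymp_on P leP"
    and transP: "transp_on P leP"
    and directed: "\<And>p q. \<lbrakk>p \<in> P; q \<in> P\<rbrakk> \<Longrightarrow> \<exists>r\<in>P. leP p r \<and> leP q r"

text \<open>
  The bonding map from the system at \<open>q\<close> to the one at \<open>p\<close> is \<open>f q p\<close>; it is
  only constrained for \<open>p < q\<close>.  Since all systems are finite, placing their
  carriers in one common type is no restriction.
\<close>

locale finite_inverse_system = directed_poset P leP
  for P :: "'i set" and leP :: "'i \<Rightarrow> 'i \<Rightarrow> bool" +
  fixes S :: "'i \<Rightarrow> 'a sepsys" and f :: "'i \<Rightarrow> 'i \<Rightarrow> 'a \<Rightarrow> 'a"
  assumes sepsys: "\<And>p. p \<in> P \<Longrightarrow> separation_system (S p)"
    and finite_seps: "\<And>p. p \<in> P \<Longrightarrow> finite (seps (S p))"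
    and hom: "\<And>p q. \<lbrakk>p \<in> P; q \<in> P; leP p q; p \<noteq> q\<rbrakk> \<Longrightarrow> sepsys_hom (S q) (S p) (f q p)"
    and compatible: "\<And>p q r s. \<lbrakk>p \<in> P; q \<in> P; r \<in> P; leP p q; p \<noteq> q; leP q r; q \<noteq> r;
        s \<in> seps (S r)\<rbrakk> \<Longrightarrow> f q p (f r q s) = f r p s"

text \<open>
  Families indexed by \<open>P\<close> are functions that are \<open>undefined\<close> outside \<open>P\<close>, as in
  the library's product topology.
\<close>

definition inverse_limit ::
  "'i set \<Rightarrow> ('i \<Rightarrow> 'i \<Rightarrow> bool) \<Rightarrow> ('i \<Rightarrow> 'a sepsys) \<Rightarrow> ('i \<Rightarrow> 'i \<Rightarrow> 'a \<Rightarrow> 'a) \<Rightarrow> ('i \<Rightarrow> 'a) sepsys"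
where
  "inverse_limit P leP S f =
     \<lparr>seps = {s \<in> (\<Pi>\<^sub>E p\<in>P. seps (S p)).
               \<forall>p\<in>P. \<forall>q\<in>P. leP p q \<and> p \<noteq> q \<longrightarrow> f q p (s q) = s p},
      le = (\<lambda>s t. \<forall>p\<in>P. le (S p) (s p) (t p)),
      invol = (\<lambda>s. \<lambda>p\<in>P. invol (S p) (s p))\<rparr>"

definition inverse_limit_topology ::
  "'i set \<Rightarrow> ('i \<Rightarrow> 'i \<Rightarrow> bool) \<Rightarrow> ('i \<Rightarrow> 'a sepsys) \<Rightarrow> ('i \<Rightarrow> 'i \<Rightarrow> 'a \<Rightarrow> 'a) \<Rightarrow> ('i \<Rightarrow> 'a) topology"
where
  "inverse_limit_topology P leP S f =
     subtopology (product_topology (\<lambda>p. discrete_topology (seps (S p))) P)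
       (seps (inverse_limit P leP S f))"

definition normal :: "'a sepsys \<Rightarrow> 'a topology \<Rightarrow> bool" where
  "normal S X \<longleftrightarrow>
     nested S \<and>
     {Q. orientation S Q \<and> consistent S Q \<and> splits S Q} =
     {Q. orientation S Q \<and> consistent S Q \<and> closedin X Q}"

context finite_inverse_system
begin

lemma separation_system_inverse_limit: "separation_system (inverse_limit P leP S f)"
proof -
  let ?L = "inverse_limit P leP S f"
  have mem: "s p \<in> seps (S p)" if "s \<in> seps ?L" "p \<in> P" for s p
    using that by (auto simp: inverse_limit_def)
  show ?thesis
  proof
    show "reflp_on (seps ?L) (le ?L)"
    proof (rule reflp_onI)
      fix s assume s: "s \<in> seps ?L"
      have "le (S p) (s p) (s p)" if "p \<in> P" for p
        using separation_system.le_refl[OF sepsys[OF that]] mem[OF s that]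
        by (auto dest: reflp_onD)
      then show "le ?L s s" by (simp add: inverse_limit_def)
    qed
    show "antisymp_on (seps ?L) (le ?L)"
    proof (rule antisymp_onI)
      fix s t assume s: "s \<in> seps ?L" and t: "t \<in> seps ?L" and st: "le ?L s t" and ts: "le ?L t s"
      have "s p = t p" if "p \<in> P" for p
        using antisymp_onD[OF separation_system.le_antisym[OF sepsys[OF that]] mem[OF s that] mem[OF t that]]
          st ts that by (simp add: inverse_limit_def)
      moreover have "s \<in> extensional P" "t \<in> extensional P"
        using s t by (auto simp: inverse_limit_def PiE_def)
      ultimately show "s = t" by (metis extensionalityI)
    qed
    show "transp_on (seps ?L) (le ?L)"
    proof (rule transp_onI)
      fix s t u assume s: "s \<in> seps ?L" and t: "t \<in> seps ?L" and u: "u \<in> seps ?L"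
        and st: "le ?L s t" and tu: "le ?L t u"
      have "le (S p) (s p) (u p)" if "p \<in> P" for p
        using transp_onD[OF separation_system.le_trans[OF sepsys[OF that]]
            mem[OF s that] mem[OF t that] mem[OF u that]] st tu that
        by (simp add: inverse_limit_def)
      then show "le ?L s u" by (simp add: inverse_limit_def)
    qed
    show "invol ?L \<in> seps ?L \<rightarrow> seps ?L"
    proof
      fix s assume s: "s \<in> seps ?L"
      have "invol (S p) (s p) \<in> seps (S p)" if "p \<in> P" for p
        using separation_system.invol_closed[OF sepsys[OF that]] mem[OF s that] by auto
      moreover have "f q p (invol (S q) (s q)) = invol (S p) (s p)"
        if "p \<in> P" "q \<in> P" "leP p q" "p \<noteq> q" for p q
        using hom[OF that] mem[OF s that(2)] s that by (simp add: sepsys_hom_def inverse_limit_def)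
      ultimately show "invol ?L s \<in> seps ?L" by (simp add: inverse_limit_def)
    qed
    show "invol ?L (invol ?L s) = s" if s: "s \<in> seps ?L" for s
    proof (rule extensionalityI)
      show "invol ?L (invol ?L s) \<in> extensional P" by (simp add: inverse_limit_def)
      show "s \<in> extensional P" using s by (auto simp: inverse_limit_def PiE_def)
      show "invol ?L (invol ?L s) p = s p" if "p \<in> P" for p
        using separation_system.involution[OF sepsys[OF that] mem[OF s that]] that
        by (simp add: inverse_limit_def)
    qed
    show "le ?L (invol ?L s) (invol ?L r)"
      if r: "r \<in> seps ?L" and s: "s \<in> seps ?L" and rs: "le ?L r s" for r s
      using separation_system.order_reversing[OF sepsys] mem[OF r] mem[OF s] rs
      by (simp add: inverse_limit_def)
  qed
qed

lemma topspace_inverse_limit_topology: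
  "topspace (inverse_limit_topology P leP S f) = seps (inverse_limit P leP S f)"
  by (auto simp: inverse_limit_topology_def inverse_limit_def)

end

end

theory Submission
  imports Defs
begin

text \<open>
  Compactness of \<open>S\<close>, together with closedness of all principal up-sets and down-sets, is the only
  topological input.  By Zorn's lemma it makes every closed consistent orientation split.

  An accumulation point \<open>x\<close> of an infinite star is small, i.e. \<open>x \<le> x\<^sup>*\<close>, and lies in the closure
  of the splitting consistent orientation consisting of all elements below \<open>x\<^sup>*\<close> other than \<open>x\<close>,
  which is therefore not closed.

  Conversely, the maximal elements of a consistent orientation \<open>Q\<close> form a star.  If this star is
  finite and \<open>Q\<close> splits, then \<open>Q\<close> lies in a finite union of closed down-sets, so by consistency a
  limit \<open>x\<close> of \<open>Q\<close> outside \<open>Q\<close> is the inverse of a maximal element, and \<open>x\<close> is small.  Every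
  element of \<open>Q\<close> other than \<open>x\<^sup>*\<close> is comparable with some element of a maximal star \<open>\<sigma>\<close> in
  \<open>Q - {x\<^sup>*}\<close>; if \<open>\<sigma>\<close> were finite, closedness would
  carry this over to the limit \<open>x\<close>, contradicting nontriviality.
\<close>

section \<open>Calculus of the involution, and maximal stars\<close>

context separation_system
begin

lemma invol_in [simp]: "s \<in> seps S \<Longrightarrow> invol S s \<in> seps S"
  using invol_closed by blast

lemma refl_le [simp]: "s \<in> seps S \<Longrightarrow> le S s s"
  using le_refl by (auto dest: reflp_onD)

lemma antisym_le: "\<lbrakk>r \<in> seps S; s \<in> seps S; le S r s; le S s r\<rbrakk> \<Longrightarrow> r = s"
  using le_antisym by (auto dest: antisymp_onD)

lemma trans_le:
  "\<lbrakk>r \<in> seps S; s \<in> seps S; t \<in> seps S; le S r s; le S s t\<rbrakk> \<Longrightarrow> le S r t"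
  using le_trans by (blast dest: transp_onD)

lemma le_invol_swap: "\<lbrakk>r \<in> seps S; s \<in> seps S; le S r (invol S s)\<rbrakk> \<Longrightarrow> le S s (invol S r)"
  using order_reversing[of r "invol S s"] involution by simp

lemma invol_le_swap: "\<lbrakk>r \<in> seps S; s \<in> seps S; le S (invol S r) s\<rbrakk> \<Longrightarrow> le S (invol S s) r"
  using order_reversing[of "invol S r" s] involution by simp

lemma invol_le_iff:
  "\<lbrakk>r \<in> seps S; s \<in> seps S\<rbrakk> \<Longrightarrow> le S (invol S r) (invol S s) \<longleftrightarrow> le S s r"
  using order_reversing[of s r] order_reversing[of "invol S r" "invol S s"] involution by auto

lemma unor_eq_iff:
  "\<lbrakk>r \<in> seps S; s \<in> seps S\<rbrakk> \<Longrightarrow> unor S r = unor S s \<longleftrightarrow> r = s \<or> r = invol S s"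
  using involution by (auto simp: unor_def)

text \<open>Zorn's lemma on the stars inside \<open>A\<close>: any two elements of the union of a
  chain lie in one member of the chain. The condition on \<open>t\<close> makes
  \<open>insert t \<sigma>\<close> a star.\<close>

lemma star_subset_maximal:
  obtains \<sigma> where "star S \<sigma>" "\<sigma> \<subseteq> A"
    "\<And>t. \<lbrakk>t \<in> A; t \<in> seps S; \<forall>s\<in>\<sigma>. t \<noteq> s \<longrightarrow> le S t (invol S s)\<rbrakk> \<Longrightarrow> t \<in> \<sigma>"
proof -
  define F where "F = {\<sigma>. star S \<sigma> \<and> \<sigma> \<subseteq> A}"
  have "\<exists>\<sigma>\<in>F. \<forall>\<tau>\<in>F. \<sigma> \<subseteq> \<tau> \<longrightarrow> \<tau> = \<sigma>"
  proof (rule subset_Zorn')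
    fix C assume "subset.chain F C"
    then have CF: "C \<subseteq> F" and tot: "\<And>X Y. \<lbrakk>X \<in> C; Y \<in> C\<rbrakk> \<Longrightarrow> X \<subseteq> Y \<or> Y \<subseteq> X"
      by (auto simp: subset_chain_def)
    have "le S r (invol S s)" if "r \<in> \<Union>C" "s \<in> \<Union>C" "r \<noteq> s" for r s
    proof -
      obtain X Y where "X \<in> C" "Y \<in> C" "r \<in> X" "s \<in> Y" using \<open>r \<in> \<Union>C\<close> \<open>s \<in> \<Union>C\<close> by blast
      then obtain Z where "Z \<in> C" "r \<in> Z" "s \<in> Z" using tot by blast
      then show ?thesis using CF \<open>r \<noteq> s\<close> by (auto simp: F_def star_def)
    qed
    moreover have "\<Union>C \<subseteq> seps S \<inter> A" using CF by (auto simp: F_def star_def)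
    ultimately show "\<Union>C \<in> F" by (simp add: F_def star_def)
  qed
  then obtain \<sigma> where \<sigma>: "star S \<sigma>" "\<sigma> \<subseteq> A"
    and max: "\<And>\<tau>. \<lbrakk>star S \<tau>; \<tau> \<subseteq> A; \<sigma> \<subseteq> \<tau>\<rbrakk> \<Longrightarrow> \<tau> = \<sigma>"
    by (auto simp: F_def)
  have "t \<in> \<sigma>" if "t \<in> A" "t \<in> seps S" "\<forall>s\<in>\<sigma>. t \<noteq> s \<longrightarrow> le S t (invol S s)" for t
  proof -
    have "star S (insert t \<sigma>)"
      using \<sigma>(1) that le_invol_swap by (auto simp: star_def)
    then show ?thesis using max[of "insert t \<sigma>"] \<sigma>(2) \<open>t \<in> A\<close> by auto
  qed
  then show thesis using that \<sigma> by blast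
qed

end

section \<open>Nestedness, consistent orientations and small elements in tree sets\<close>

context tree_set
begin

lemma invol_neq: "s \<in> seps S \<Longrightarrow> invol S s \<noteq> s"
  using no_degenerate[of s] by (auto simp: degenerate_def)

text \<open>Nontriviality in the form used below: for any other \<open>s\<close>, both inequalities
  would be strict and \<open>s\<close> would witness that \<open>r\<close> is trivial.\<close>

lemma le_both:
  assumes "r \<in> seps S" "s \<in> seps S" "le S r s" "le S r (invol S s)"
  shows "s = r \<or> s = invol S r"
proof (rule ccontr)
  assume "\<not> ?thesis"
  then have "unor S s \<noteq> unor S r" "lt S r s" "lt S r (invol S s)"
    using assms involution[OF \<open>s \<in> seps S\<close>] by (auto simp: unor_eq_iff lt_def)
  then show False using no_trivial[OF assms(1)] assms(2) by (auto simp: trivial_def)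
qed

text \<open>The involution pairs up the eight possible comparisons of orientations, so four cases
  suffice.\<close>

lemma nested_cases:
  assumes "r \<in> seps S" "s \<in> seps S"
  obtains "le S r s" | "le S s r" | "le S r (invol S s)" | "le S (invol S r) s"
proof -
  have "nested_pair S r s" using nested_seps assms by (auto simp: nested_def)
  then consider "le S r s" | "le S s r" | "le S r (invol S s)" | "le S (invol S r) s"
    | "le S s (invol S r)" | "le S (invol S s) r"
    | "le S (invol S r) (invol S s)" | "le S (invol S s) (invol S r)"
    unfolding nested_pair_def unor_def by blast
  then show thesis
  proof cases
    case 5
    then show thesis using le_invol_swap[OF assms(2,1)] that(3) by blast
  next
    case 6
    then show thesis using invol_le_swap[OF assms(2,1)] that(4) by blast
  next
    case 7
    then show thesis using invol_le_iff[OF assms] that(2) by blast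
  next
    case 8
    then show thesis using invol_le_iff[OF assms(2,1)] that(1) by blast
  qed (fact that)+
qed

lemma orientation_iff:
  assumes "orientation S Q" "s \<in> seps S"
  shows "invol S s \<in> Q \<longleftrightarrow> s \<notin> Q"
proof -
  have "\<exists>!r. r \<in> unor S s \<and> r \<in> Q" using assms by (auto simp: orientation_def)
  then show ?thesis using invol_neq[OF assms(2)] by (auto simp: unor_def)
qed

lemma orientationI:
  assumes "Q \<subseteq> seps S" "\<And>s. s \<in> seps S \<Longrightarrow> invol S s \<in> Q \<longleftrightarrow> s \<notin> Q"
  shows "orientation S Q"
  unfolding orientation_def
proof (intro conjI ballI)
  fix s assume "s \<in> seps S"
  then show "\<exists>!r. r \<in> unor S s \<and> r \<in> Q"
    using assms(2)[of s] by (cases "s \<in> Q") (auto simp: unor_def)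
qed (fact assms)

text \<open>Consistency compares only distinct unoriented separations, so down-closure may fail at
  \<open>invol S s\<close>. This exception is where a limit point outside \<open>Q\<close> can
  sit.\<close>

lemma consistent_le:
  assumes "orientation S Q" "consistent S Q" "r \<in> seps S" "s \<in> Q" "le S r s" "r \<noteq> invol S s"
  shows "r \<in> Q"
proof (rule ccontr)
  assume "r \<notin> Q"
  have s: "s \<in> seps S" using assms by (auto simp: orientation_def)
  have "invol S r \<in> Q" using orientation_iff assms \<open>r \<notin> Q\<close> by blast
  moreover have "r \<noteq> s" using \<open>r \<notin> Q\<close> assms by auto
  ultimately show False
    using assms s by (auto simp: consistent_def lt_def unor_eq_iff)
qed

text \<open>If \<open>invol S r\<close> were below \<open>s\<close>, with \<open>r\<close> and
  \<open>s\<close> distinct, then \<open>consistent_le\<close> would put \<open>invol S r\<close>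
  into \<open>Q\<close> alongside \<open>r\<close>.\<close>

lemma consistent_cases:
  assumes Q: "orientation S Q" "consistent S Q" and rs: "r \<in> Q" "s \<in> Q"
  obtains "le S r s" | "le S s r" | "le S r (invol S s)"
proof -
  have S: "r \<in> seps S" "s \<in> seps S" using Q(1) rs by (auto simp: orientation_def)
  have "r = s" if le: "le S (invol S r) s"
  proof (rule ccontr)
    assume "r \<noteq> s"
    then have "invol S r \<noteq> invol S s" using S involution by metis
    then have "invol S r \<in> Q" using consistent_le[OF Q _ \<open>s \<in> Q\<close> le] S by simp
    then show False using orientation_iff[OF Q(1)] rs S by blast
  qed
  then show thesis using nested_cases[OF S] that refl_le[OF S(1)] by blast
qed

lemma star_maximal_elements:
  assumes Q: "orientation S Q" "consistent S Q"
  shows "star S (maximal_elements S Q)"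
  unfolding star_def
proof (intro conjI ballI impI)
  show "maximal_elements S Q \<subseteq> seps S"
    using Q by (auto simp: maximal_elements_def orientation_def)
  fix r s assume "r \<in> maximal_elements S Q" "s \<in> maximal_elements S Q" "r \<noteq> s"
  then have "r \<in> Q" "s \<in> Q" "\<not> le S r s" "\<not> le S s r"
    by (auto simp: maximal_elements_def lt_def)
  then show "le S r (invol S s)" using consistent_cases[OF Q, of r s] by blast
qed

lemma small_minimal:
  assumes "x \<in> seps S" "le S x (invol S x)" "t \<in> seps S" "le S t x"
  shows "t = x"
proof -
  have "le S t (invol S x)" using trans_le[of t x "invol S x"] assms by simp
  then have "x = t \<or> x = invol S t" using le_both assms by blast
  moreover have "t = x" if "x = invol S t"
    using that assms involution antisym_le[of x t] by auto
  ultimately show ?thesis by auto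
qed

text \<open>Exactly one of \<open>t\<close> and \<open>invol S t\<close> lies above
  \<open>x\<close>: nontriviality excludes both, and nestedness with smallness of \<open>x\<close>
  yields one. Inverting turns this into a statement about lying below
  \<open>invol S x\<close>.\<close>

lemma small_le_iff:
  assumes x: "x \<in> seps S" "le S x (invol S x)" and t: "t \<in> seps S" "t \<noteq> x" "t \<noteq> invol S x"
  shows "le S (invol S t) (invol S x) \<longleftrightarrow> \<not> le S t (invol S x)"
proof -
  have "\<not> (le S x t \<and> le S x (invol S t))"
    using le_both[of x t] x t by auto
  moreover have "le S x t \<or> le S x (invol S t)"
  proof (rule nested_cases[of x t])
    assume "le S t x"
    then show ?thesis using small_minimal x t by blast
  next
    assume "le S (invol S x) t"
    then show ?thesis using trans_le[of x "invol S x" t] x t by auto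
  qed (use x t in auto)
  moreover have "le S x (invol S t) \<longleftrightarrow> le S t (invol S x)"
    using le_invol_swap x t by blast
  ultimately show ?thesis using invol_le_iff x t by blast
qed

text \<open>Both \<open>x\<close> and its inverse lie below \<open>invol S x\<close>, so
  \<open>x\<close> has to be removed. What remains has \<open>invol S x\<close> as its greatest
  element and therefore splits.\<close>

lemma small_orientation:
  assumes x: "x \<in> seps S" "le S x (invol S x)"
  defines "Q \<equiv> {t \<in> seps S. le S t (invol S x)} - {x}"
  shows "orientation S Q" "consistent S Q" "splits S Q"
proof -
  show or: "orientation S Q"
  proof (rule orientationI)
    fix s assume s: "s \<in> seps S"
    consider "s = x" | "s = invol S x" | "s \<noteq> x" "s \<noteq> invol S x" by blast
    then show "invol S s \<in> Q \<longleftrightarrow> s \<notin> Q"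
    proof cases
      case 3
      then have "invol S s \<noteq> x" using involution s by auto
      then show ?thesis using small_le_iff[OF x s] 3 s by (auto simp: Q_def)
    qed (use x invol_neq involution in \<open>auto simp: Q_def\<close>)
  qed (auto simp: Q_def)
  have "False" if r: "r \<in> seps S" "invol S r \<in> Q" and s: "s \<in> seps S" "s \<in> Q"
    and ne: "unor S r \<noteq> unor S s" and lt: "lt S r s" for r s
  proof -
    have "le S r (invol S x)"
      using trans_le[of r s "invol S x"] r s x lt by (auto simp: Q_def lt_def)
    moreover have "r \<notin> Q" using orientation_iff[OF or] r by blast
    \<comment> \<open>Among the elements below \<open>invol S x\<close>, only \<open>x\<close> is
      missing from \<open>Q\<close>.\<close>
    ultimately have "r = x" using r by (auto simp: Q_def)
    then have "le S x s" "le S x (invol S s)"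
      using lt s x le_invol_swap by (auto simp: lt_def Q_def)
    then show False using le_both[of x s] x s ne \<open>r = x\<close> involution
      by (auto simp: unor_eq_iff)
  qed
  then show "consistent S Q" by (auto simp: consistent_def)
  have "invol S x \<in> maximal_elements S Q"
    using x invol_neq antisym_le by (auto simp: maximal_elements_def Q_def lt_def)
  then show "splits S Q" by (auto simp: splits_def down_closure_def Q_def)
qed

end

section \<open>Closed versus splitting orientations in compact tree sets\<close>

locale compact_tree_set = tree_set S for S :: "'a sepsys" +
  fixes X :: "'a topology"
  assumes topspace: "topspace X = seps S"
    and compact: "compact_space X"
    and closed_down: "\<And>s. s \<in> seps S \<Longrightarrow> closedin X {t \<in> seps S. le S t s}"
    and closed_up: "\<And>s. s \<in> seps S \<Longrightarrow> closedin X {t \<in> seps S. le S s t}"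
begin

lemma closed_imp_splits:
  assumes "closedin X Q"
  shows "splits S Q"
proof -
  have QS: "Q \<subseteq> seps S" using assms closedin_subset topspace by metis
  have "q \<in> down_closure S (maximal_elements S Q)" if q: "q \<in> Q" for q
  proof -
    define A where "A = {t \<in> Q. le S q t}"
    define R where "R = {(r, s). r \<in> A \<and> s \<in> A \<and> le S r s}"
    have AS: "A \<subseteq> seps S" using QS by (auto simp: A_def)
    have qA: "q \<in> A" using q QS by (auto simp: A_def)
    have field: "Field R = A" using AS by (fastforce simp: R_def Field_def)
    have po: "Partial_order R"
      unfolding partial_order_on_def preorder_on_def field
    proof (intro conjI)
      show "R \<subseteq> A \<times> A" by (auto simp: R_def)
      show "refl_on A R" using AS by (auto simp: refl_on_def R_def)
      show "trans R" unfolding trans_def R_def using AS trans_le by blast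
      show "antisym R" unfolding antisym_def R_def using AS antisym_le by blast
    qed
    have "\<exists>m\<in>Field R. \<forall>a\<in>Field R. (m, a) \<in> R \<longrightarrow> a = m"
    proof (rule Zorns_po_lemma[OF po], unfold field)
      fix C assume "C \<in> Chains R"
      then have "\<And>r s. \<lbrakk>r \<in> C; s \<in> C\<rbrakk> \<Longrightarrow> (r, s) \<in> R \<or> (s, r) \<in> R"
        by (auto simp: Chains_def)
      \<comment> \<open>Adding \<open>q\<close> to the chain also covers the empty chain and ensures
        that the bound found below lies above \<open>q\<close>.\<close>
      then have CA: "insert q C \<subseteq> A"
        and tot: "\<And>r s. \<lbrakk>r \<in> insert q C; s \<in> insert q C\<rbrakk> \<Longrightarrow> le S r s \<or> le S s r"
        using qA by (auto simp: R_def A_def)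
      \<comment> \<open>A common point of all these closed sets is an upper bound of
        \<open>C\<close> in \<open>Q\<close>. The finite intersection property holds because every
        finite part of the chain is bounded inside the chain.\<close>
      define U where "U c = Q \<inter> {t \<in> seps S. le S c t}" for c
      have fin: "\<exists>u\<in>insert q C. \<forall>c\<in>D. le S c u" if "finite D" "D \<subseteq> insert q C" for D
        using that
      proof (induction D)
        case (insert c D)
        then obtain u where u: "u \<in> insert q C" "\<forall>c\<in>D. le S c u" by auto
        show ?case
        proof (cases "le S c u")
          case False
          then have "le S u c" using tot u insert.prems by blast
          moreover have "insert c (insert u D) \<subseteq> seps S" using CA AS u insert.prems by blast
          ultimately have "\<forall>d\<in>insert c D. le S d c"
            using u trans_le[of _ u c] by auto
          then show ?thesis using insert.prems by blast
        qed (use u in blast)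
      qed auto
      have "\<Inter>(U ` insert q C) \<noteq> {}"
      proof (rule compact_space_fip[THEN iffD1, OF compact, rule_format], intro conjI ballI allI impI)
        fix K assume "K \<in> U ` insert q C"
        then show "closedin X K"
          using assms closed_up CA AS by (auto simp: U_def intro!: closedin_Int)
      next
        fix F assume "finite F \<and> F \<subseteq> U ` insert q C"
        then obtain D where D: "D \<subseteq> insert q C" "finite D" "F = U ` D"
          using finite_subset_image by metis
        then obtain u where "u \<in> insert q C" "\<forall>c\<in>D. le S c u" using fin by blast
        then have "u \<in> \<Inter>F" using D CA AS by (auto simp: U_def A_def)
        then show "\<Inter>F \<noteq> {}" by blast
      qed
      then obtain u where "u \<in> \<Inter>(U ` insert q C)" by blast
      then have u: "u \<in> U c" if "c \<in> insert q C" for c using that by blast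
      have "u \<in> A" using u[of q] by (simp add: U_def A_def)
      moreover have "le S a u" if "a \<in> C" for a using u[of a] that by (simp add: U_def)
      ultimately show "\<exists>u\<in>A. \<forall>a\<in>C. (a, u) \<in> R"
        using CA by (auto simp: R_def)
    qed
    then obtain m where m: "m \<in> A" "\<And>a. \<lbrakk>a \<in> A; le S m a\<rbrakk> \<Longrightarrow> a = m"
      unfolding field by (auto simp: R_def)
    \<comment> \<open>Anything in \<open>Q\<close> above \<open>m\<close> is above \<open>q\<close>,
      hence in \<open>A\<close>, so maximality in \<open>A\<close> gives maximality in
      \<open>Q\<close>.\<close>
    have "m \<in> maximal_elements S Q"
      unfolding maximal_elements_def
    proof (intro CollectI conjI notI)
      show "m \<in> Q" using m by (simp add: A_def)
      assume "\<exists>s\<in>Q. lt S m s"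
      then obtain s where s: "s \<in> Q" "le S m s" "m \<noteq> s" by (auto simp: lt_def)
      then have "le S q s" using trans_le[of q m s] m(1) q QS by (auto simp: A_def)
      then show False using m(2)[of s] s by (auto simp: A_def)
    qed
    then show ?thesis using m(1) q QS by (auto simp: down_closure_def A_def)
  qed
  then show ?thesis by (auto simp: splits_def)
qed

lemma infinite_star_not_closed:
  assumes "star S \<sigma>" "infinite \<sigma>"
  obtains Q where "orientation S Q" "consistent S Q" "splits S Q" "\<not> closedin X Q"
proof -
  have \<sigma>S: "\<sigma> \<subseteq> seps S" using assms by (simp add: star_def)
  \<comment> \<open>Bolzano-Weierstrass: an infinite subset of a compact space has an accumulation
    point.\<close>
  have "topspace X \<inter> X derived_set_of \<sigma> \<noteq> {}"
    using compactin_imp_Bolzano_Weierstrass[of X "topspace X" \<sigma>] compact assms \<sigma>S topspace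
    by (metis compact_space_def)
  then obtain x where x: "x \<in> seps S" "x \<in> X derived_set_of \<sigma>" using topspace by auto
  have limit: "x \<in> C" if "closedin X C" "\<sigma> - {x} \<subseteq> C" for C
  proof (rule ccontr)
    assume "x \<notin> C"
    moreover have "openin X (topspace X - C)" using that by blast
    moreover have "x \<in> topspace X" using x topspace by simp
    ultimately obtain y where "y \<noteq> x" "y \<in> \<sigma>" "y \<in> topspace X - C"
      using x(2) unfolding in_derived_set_of by blast
    then show False using that by blast
  qed
  have le: "le S s (invol S x)" if s: "s \<in> \<sigma>" "s \<noteq> x" for s
  proof -
    have sS: "s \<in> seps S" using s \<sigma>S by auto
    \<comment> \<open>By antisymmetry the intersection is the singleton of \<open>s\<close>, closed
      as a down-set cut with an up-set. The star condition at \<open>s\<close> thus passes to the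
      limit \<open>x\<close>.\<close>
    have "x \<in> {t \<in> seps S. le S t (invol S s)} \<union> ({t \<in> seps S. le S t s} \<inter> {t \<in> seps S. le S s t})"
    proof (rule limit)
      show "closedin X ({t \<in> seps S. le S t (invol S s)} \<union>
        ({t \<in> seps S. le S t s} \<inter> {t \<in> seps S. le S s t}))"
        using sS closed_down closed_up by (intro closedin_Un closedin_Int) auto
      show "\<sigma> - {x} \<subseteq> {t \<in> seps S. le S t (invol S s)} \<union>
        ({t \<in> seps S. le S t s} \<inter> {t \<in> seps S. le S s t})"
      proof
        fix t assume "t \<in> \<sigma> - {x}"
        then have "t \<in> seps S" "t = s \<or> le S t (invol S s)"
          using assms(1) \<open>s \<in> \<sigma>\<close> unfolding star_def by blast+
        then show "t \<in> {t \<in> seps S. le S t (invol S s)} \<union>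
          ({t \<in> seps S. le S t s} \<inter> {t \<in> seps S. le S s t})"
          using refl_le[OF sS] by blast
      qed
    qed
    then have "le S x (invol S s)" using antisym_le[of x s] s sS x(1) by blast
    then show ?thesis using le_invol_swap x sS by blast
  qed
  define Q where "Q = {t \<in> seps S. le S t (invol S x)} - {x}"
  \<comment> \<open>A second passage to the limit: now the star itself lies below
    \<open>invol S x\<close>, hence so does \<open>x\<close>.\<close>
  have "\<sigma> - {x} \<subseteq> {t \<in> seps S. le S t (invol S x)}" using le \<sigma>S by blast
  then have "x \<in> {t \<in> seps S. le S t (invol S x)}"
    by (rule limit[OF closed_down[OF invol_in[OF x(1)]]])
  then have small: "le S x (invol S x)" by simp
  have "\<not> closedin X Q"
  proof
    assume "closedin X Q"
    moreover have "\<sigma> - {x} \<subseteq> Q" using le \<sigma>S unfolding Q_def by blast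
    ultimately have "x \<in> Q" by (rule limit)
    then show False by (simp add: Q_def)
  qed
  then show thesis
    using that[of Q] small_orientation[OF x(1) small] unfolding Q_def by blast
qed

lemma splits_imp_closed:
  assumes Q: "orientation S Q" "consistent S Q" "splits S Q"
    and star_finite: "\<And>\<sigma>. star S \<sigma> \<Longrightarrow> finite \<sigma>"
  shows "closedin X Q"
proof (rule ccontr)
  assume "\<not> closedin X Q"
  have QS: "Q \<subseteq> seps S" using Q by (simp add: orientation_def)
  then obtain x where x: "x \<in> X closure_of Q" "x \<notin> Q"
    using \<open>\<not> closedin X Q\<close> closure_of_subset_eq[of Q X] topspace by auto
  have xS: "x \<in> seps S" using x in_closure_of topspace by metis
  have limit: "x \<in> C" if "closedin X C" "Q \<subseteq> C" for C
    using closure_of_minimal[of Q C X] that x by auto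
  define M where "M = maximal_elements S Q"
  have MQ: "M \<subseteq> Q" by (auto simp: M_def maximal_elements_def)
  \<comment> \<open>Splitting covers \<open>Q\<close> by the down-sets of its maximal elements,
    which form a star and so are finite in number.\<close>
  have "x \<in> (\<Union>m\<in>M. {t \<in> seps S. le S t m})"
  proof (rule limit)
    show "closedin X (\<Union>m\<in>M. {t \<in> seps S. le S t m})"
    proof (rule closedin_Union)
      show "finite ((\<lambda>m. {t \<in> seps S. le S t m}) ` M)"
        using star_finite[OF star_maximal_elements[OF Q(1,2)]] by (simp add: M_def)
    qed (use closed_down MQ QS in auto)
    show "Q \<subseteq> (\<Union>m\<in>M. {t \<in> seps S. le S t m})"
      using Q(3) by (auto simp: splits_def down_closure_def M_def)
  qed
  then obtain m where m: "m \<in> M" "le S x m" by auto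
  then have mQ: "m \<in> Q" and mS: "m \<in> seps S" using MQ QS by auto
  \<comment> \<open>Since \<open>x\<close> is below \<open>m\<close> but not in \<open>Q\<close>, it
    must be the exception in \<open>consistent_le\<close>.\<close>
  have xm: "x = invol S m" using consistent_le[OF Q(1,2) xS mQ] m x by auto
  \<comment> \<open>The star is sought away from \<open>m\<close>, because comparability of
    \<open>x\<close> with its own inverse \<open>m\<close> would give no contradiction.\<close>
  have small: "le S x (invol S x)" using xm m involution mS by simp
  obtain \<sigma> where \<sigma>: "star S \<sigma>" "\<sigma> \<subseteq> Q - {m}"
    and max: "\<And>t. \<lbrakk>t \<in> Q - {m}; t \<in> seps S; \<forall>s\<in>\<sigma>. t \<noteq> s \<longrightarrow> le S t (invol S s)\<rbrakk> \<Longrightarrow> t \<in> \<sigma>"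
    using star_subset_maximal[of "Q - {m}"] by blast
  define D where "D s = {t \<in> seps S. le S t s} \<union> {t \<in> seps S. le S s t}" for s
  \<comment> \<open>The first set is the singleton of \<open>m\<close>. An element of
    \<open>Q\<close> outside the union would point towards every member of \<open>\<sigma>\<close>,
    so by maximality it would belong to \<open>\<sigma>\<close> and be comparable with
    itself.\<close>
  have "x \<in> ({t \<in> seps S. le S t m} \<inter> {t \<in> seps S. le S m t}) \<union> (\<Union>s\<in>\<sigma>. D s)"
  proof (rule limit)
    have "closedin X (\<Union>s\<in>\<sigma>. D s)"
    proof (rule closedin_Union)
      fix T assume "T \<in> D ` \<sigma>"
      then show "closedin X T"
        using closed_down closed_up \<sigma> QS by (auto simp: D_def intro!: closedin_Un)
    qed (use star_finite \<sigma> in auto)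
    then show "closedin X (({t \<in> seps S. le S t m} \<inter> {t \<in> seps S. le S m t}) \<union> (\<Union>s\<in>\<sigma>. D s))"
      using closed_down closed_up mS by (intro closedin_Un closedin_Int) auto
    show "Q \<subseteq> ({t \<in> seps S. le S t m} \<inter> {t \<in> seps S. le S m t}) \<union> (\<Union>s\<in>\<sigma>. D s)"
    proof
      fix t assume t: "t \<in> Q"
      have tS: "t \<in> seps S" using t QS by auto
      show "t \<in> ({t \<in> seps S. le S t m} \<inter> {t \<in> seps S. le S m t}) \<union> (\<Union>s\<in>\<sigma>. D s)"
      proof (rule ccontr)
        assume no: "\<not> ?thesis"
        then have "t \<noteq> m" using mS by auto
        moreover have "\<forall>s\<in>\<sigma>. le S t (invol S s)"
        proof
          fix s assume s: "s \<in> \<sigma>"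
          then have "\<not> le S t s" "\<not> le S s t" using no tS by (auto simp: D_def)
          then show "le S t (invol S s)"
            using consistent_cases[OF Q(1,2) t, of s] s \<sigma> by blast
        qed
        ultimately have "t \<in> \<sigma>" using max t tS by blast
        then show False using no tS by (auto simp: D_def)
      qed
    qed
  qed
  moreover have "x \<noteq> m" using x mQ by auto
  ultimately obtain s where s: "s \<in> \<sigma>" "le S x s \<or> le S s x"
    using antisym_le xS mS by (auto simp: D_def)
  have sQ: "s \<in> Q" "s \<noteq> m" "s \<noteq> x" "s \<in> seps S" using s \<sigma> x QS by auto
  have not_le: "\<not> le S s x" using small_minimal[OF xS small] sQ by blast
  then have xs: "le S x s" using s by blast
  \<comment> \<open>Of the three cases for \<open>s\<close> and \<open>m\<close>, maximality of
    \<open>m\<close> settles \<open>le S m s\<close>, and \<open>le S s (invol S m)\<close> is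
    \<open>le S s x\<close>. Inverting the result puts \<open>x\<close> below both orientations of
    \<open>s\<close>.\<close>
  have "le S s m"
  proof (rule consistent_cases[OF Q(1,2) sQ(1) mQ])
    assume "le S m s"
    then show ?thesis using m(1) sQ by (auto simp: M_def maximal_elements_def lt_def)
  qed (use not_le xm in auto)
  then have "le S x (invol S s)" using xm invol_le_iff sQ mS by simp
  then show False using le_both[OF xS sQ(4) xs] sQ xm involution mS by auto
qed

lemma normal_iff_no_infinite_star:
  "normal S X \<longleftrightarrow> \<not> (\<exists>\<sigma>. star S \<sigma> \<and> infinite \<sigma>)"
proof
  assume "normal S X"
  then have "\<lbrakk>orientation S Q; consistent S Q; splits S Q\<rbrakk> \<Longrightarrow> closedin X Q" for Q
    unfolding normal_def by blast
  then show "\<not> (\<exists>\<sigma>. star S \<sigma> \<and> infinite \<sigma>)" using infinite_star_not_closed by metis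
next
  assume "\<not> (\<exists>\<sigma>. star S \<sigma> \<and> infinite \<sigma>)"
  then show "normal S X"
    using nested_seps splits_imp_closed closed_imp_splits unfolding normal_def by blast
qed

end

section \<open>Topology of the inverse limit\<close>

context finite_inverse_system
begin

abbreviation "L \<equiv> inverse_limit P leP S f"
abbreviation "X \<equiv> inverse_limit_topology P leP S f"

lemma limit_component: "\<lbrakk>s \<in> seps L; p \<in> P\<rbrakk> \<Longrightarrow> s p \<in> seps (S p)"
  by (auto simp: inverse_limit_def)

text \<open>Tychonoff makes the product of the finite discrete spaces compact. The limit is closed
  in it, being cut out by equalizers of continuous maps into Hausdorff spaces.\<close>

lemma compact_space_inverse_limit: "compact_space X"
proof -
  let ?Y = "product_topology (\<lambda>p. discrete_topology (seps (S p))) P"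
  have proj: "continuous_map ?Y (discrete_topology (seps (S p))) (\<lambda>s. s p)" if "p \<in> P" for p
    using continuous_map_product_projection[OF that, of "\<lambda>p. discrete_topology (seps (S p))"] .
  define K where "K p q s \<longleftrightarrow> f q p (s q) = s p" for p q s
  define E where "E = (\<lambda>(p, q). {s \<in> topspace ?Y. K p q s})"
  define B where "B = {(p, q). p \<in> P \<and> q \<in> P \<and> leP p q \<and> p \<noteq> q}"
  have "closedin ?Y (E pq)" if "pq \<in> B" for pq
  proof -
    obtain p q where pq: "pq = (p, q)" "p \<in> P" "q \<in> P" "leP p q" "p \<noteq> q"
      using \<open>pq \<in> B\<close> by (auto simp: B_def)
    have "continuous_map (discrete_topology (seps (S q))) (discrete_topology (seps (S p))) (f q p)"
      using hom[OF pq(2-5)] by (auto simp: sepsys_hom_def)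
    then have "continuous_map ?Y (discrete_topology (seps (S p))) (f q p \<circ> (\<lambda>s. s q))"
      by (rule continuous_map_compose[OF proj[OF pq(3)]])
    then show ?thesis
      using closedin_continuous_maps_eq[OF Hausdorff_space_discrete_topology _ proj[OF pq(2)]]
      by (simp add: E_def K_def pq(1) o_def)
  qed
  then have "closedin ?Y (\<Inter>(E ` B))" if "B \<noteq> {}"
    using that by (intro closedin_Inter) blast+
  \<comment> \<open>Without bonding conditions the intersection over \<open>B\<close> is the whole
    type, hence the cut with the product space.\<close>
  then have "closedin ?Y (topspace ?Y \<inter> \<Inter>(E ` B))"
    by (cases "B = {}") (simp_all del: topspace_product_topology add: closedin_Int)
  moreover have "seps L = topspace ?Y \<inter> {s. \<forall>p\<in>P. \<forall>q\<in>P. leP p q \<and> p \<noteq> q \<longrightarrow> K p q s}"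
    unfolding K_def by (simp add: inverse_limit_def Collect_conj_eq)
  then have "seps L = topspace ?Y \<inter> \<Inter>(E ` B)"
    unfolding E_def B_def by blast
  moreover have "compact_space ?Y"
    by (simp add: compact_space_product_topology compact_space_discrete_topology finite_seps)
  ultimately have "compactin ?Y (seps L)" using closedin_compact_space by metis
  then show ?thesis by (simp add: inverse_limit_topology_def compact_space_subtopology)
qed

text \<open>Every subset of a discrete factor is closed, so these are intersections of closed
  preimages. As the order is componentwise, both up-sets and down-sets have this form.\<close>

lemma closedin_inverse_limit_components: "closedin X {t \<in> seps L. \<forall>p\<in>P. R p (t p)}"
proof -
  have "closedin X {t \<in> topspace X. t p \<in> {a \<in> seps (S p). R p a}}" if "p \<in> P" for p
  proof (rule closedin_continuous_map_preimage)
    show "continuous_map X (discrete_topology (seps (S p))) (\<lambda>t. t p)"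
      unfolding inverse_limit_topology_def
      by (intro continuous_map_from_subtopology continuous_map_product_projection that)
  qed auto
  then have "closedin X (topspace X \<inter> \<Inter>((\<lambda>p. {t \<in> topspace X. t p \<in> {a \<in> seps (S p). R p a}}) ` P))"
    by (cases "P = {}") (auto intro!: closedin_Int closedin_Inter)
  moreover have "topspace X \<inter> \<Inter>((\<lambda>p. {t \<in> topspace X. t p \<in> {a \<in> seps (S p). R p a}}) ` P)
      = {t \<in> seps L. \<forall>p\<in>P. R p (t p)}"
    using limit_component by (auto simp: topspace_inverse_limit_topology)
  ultimately show ?thesis by simp
qed

lemma compact_tree_set_inverse_limit:
  assumes "tree_set L"
  shows "compact_tree_set L X"
proof (intro compact_tree_set.intro compact_tree_set_axioms.intro)
  have le: "le L r s \<longleftrightarrow> (\<forall>p\<in>P. le (S p) (r p) (s p))" for r s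
    by (simp add: inverse_limit_def)
  show "closedin X {t \<in> seps L. le L t s}" for s
    unfolding le by (rule closedin_inverse_limit_components)
  show "closedin X {t \<in> seps L. le L s t}" for s
    unfolding le by (rule closedin_inverse_limit_components)
qed (fact assms topspace_inverse_limit_topology compact_space_inverse_limit)+

end

theorem theorem7p9:
  fixes P :: "'i set" and leP :: "'i \<Rightarrow> 'i \<Rightarrow> bool"
    and S :: "'i \<Rightarrow> 'a sepsys" and f :: "'i \<Rightarrow> 'i \<Rightarrow> 'a \<Rightarrow> 'a"
  assumes "finite_inverse_system P leP S f"
    and "tree_set (inverse_limit P leP S f)"
  shows "normal (inverse_limit P leP S f) (inverse_limit_topology P leP S f) \<longleftrightarrow>
    \<not> (\<exists>\<sigma>. star (inverse_limit P leP S f) \<sigma> \<and> infinite \<sigma>)"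
  by (rule compact_tree_set.normal_iff_no_infinite_star
      [OF finite_inverse_system.compact_tree_set_inverse_limit[OF assms]])

end
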